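(* Let $\mathcal{T}(a)$ be a regular spherical tetrahedron in $\mathbb{S}^3$ with all edge lengths equal to $a$ and all dihedral angles equal to $A$. Then its volume $V=\mathrm{vol}(\mathcal{T}(a))$ is given by either of the following formulae: \begin{align*} V&=3\int_{\arccos \frac{1}{3}}^A \arccos\left(\frac{\cos\varphi}{1-2\cos\varphi}\right)\,d\varphi,\\ V&=\int_{0}^a \frac{3\,t\sin t\,dt}{(1+2\cos t)\sqrt{(1+\cos t)(1+3\cos t)}}. \end{align*}
   Context: $\mathbb{S}^3$ is the three-dimensional spherical space of constant curvature $1$ (the unit sphere in $\mathbb{R}^4$ with its intrinsic metric and volume). A regular spherical tetrahedron is a (non-degenerate) convex tetrahedron in $\mathbb{S}^3$ with all six edges of equal length; its edges are geodesic segments and its faces are regular spherical triangles lying in great 2-spheres. Dihedral angles are the interior angles between adjacent faces. *)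

theory Defs
  imports "HOL-Analysis.Analysis"
begin

text \<open>
  The intrinsic distance between two unit vectors, i.e. the length of a shortest great-circle arc.
\<close>

definition sphere_dist :: "'a::real_inner \<Rightarrow> 'a \<Rightarrow> real" where
  "sphere_dist x y = arccos (x \<bullet> y)"

text \<open>
  The surface measure of a subset \<open>S\<close> of the unit sphere in dimension \<open>d\<close>, obtained from
  integration in polar coordinates: the part of the unit ball lying over \<open>S\<close> has
  Lebesgue measure \<open>\<integral>\<^sub>0\<^sup>1 r\<^bsup>d - 1\<^esup> vol S dr = vol S / d\<close>.
\<close>

definition sphere_volume :: "'a::euclidean_space set \<Rightarrow> real" where
  "sphere_volume S =
     real DIM('a) * measure lebesgue {r *\<^sub>R x | r x. 0 \<le> r \<and> r \<le> 1 \<and> x \<in> S}"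

lemma sphere_volume_whole_sphere: "sphere_volume (sphere 0 1 :: (real ^ 4) set) = 2 * pi\<^sup>2"
proof -
  have "{r *\<^sub>R x | r x. 0 \<le> r \<and> r \<le> 1 \<and> x \<in> sphere 0 1} = (cball 0 1 :: (real ^ 4) set)"
    (is "?L = _")
  proof
    show "?L \<subseteq> cball 0 1" by auto
    show "cball 0 1 \<subseteq> ?L"
    proof
      fix y :: "real ^ 4" assume y: "y \<in> cball 0 1"
      show "y \<in> ?L"
      proof (cases "y = 0")
        case True
        obtain x :: "real ^ 4" where "norm x = 1"
          using vector_choose_size[of 1] by auto
        then have "y = 0 *\<^sub>R x \<and> (0::real) \<le> 0 \<and> (0::real) \<le> 1 \<and> x \<in> sphere 0 1"
          using True by simp
        then show ?thesis by blast
      next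
        case False
        then have "y = norm y *\<^sub>R sgn y \<and> 0 \<le> norm y \<and> norm y \<le> 1 \<and> sgn y \<in> sphere 0 1"
          using y by (simp add: sgn_div_norm)
        then show ?thesis by blast
      qed
    qed
  qed
  moreover have "measure lebesgue (cball 0 1 :: (real ^ 4) set) = pi\<^sup>2 / 2"
    using content_cball[of 1 "0 :: real ^ 4"] by (simp add: unit_ball_vol_4)
  ultimately show ?thesis by (simp add: sphere_volume_def)
qed

text \<open>
  A spherical simplex is given by its vertices. Non-degenerate means that these are linearly
  independent, i.e. do not lie in a common great hypersphere; the simplex is
  then the set of normalised nonnegative combinations of its vertices.
\<close>

definition spherical_simplex :: "('n::finite \<Rightarrow> real ^ 'n) \<Rightarrow> (real ^ 'n) set" where
  "spherical_simplex v = convex_cone hull (range v) \<inter> sphere 0 1"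

definition nondegenerate_vertices :: "('n::finite \<Rightarrow> real ^ 'n) \<Rightarrow> bool" where
  "nondegenerate_vertices v \<longleftrightarrow> range v \<subseteq> sphere 0 1 \<and> inj v \<and> independent (range v)"

definition regular_spherical_tetrahedron :: "(4 \<Rightarrow> real ^ 4) \<Rightarrow> real \<Rightarrow> bool" where
  "regular_spherical_tetrahedron v a \<longleftrightarrow>
     nondegenerate_vertices v \<and> (\<forall>i j. i \<noteq> j \<longrightarrow> sphere_dist (v i) (v j) = a)"

text \<open>
  The angle between two nonzero vectors, and the component of a vector orthogonal to the
  span of a set (\<open>closest_point\<close> is the orthogonal projection onto this subspace).
\<close>

definition vec_angle :: "'a::real_inner \<Rightarrow> 'a \<Rightarrow> real" where
  "vec_angle x y = arccos ((x \<bullet> y) / (norm x * norm y))"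

definition orth_component :: "'a::euclidean_space set \<Rightarrow> 'a \<Rightarrow> 'a" where
  "orth_component B x = x - closest_point (span B) x"

text \<open>
  Let \<open>i \<noteq> j\<close>. The faces opposite to the vertices \<open>v i\<close> and \<open>v j\<close> meet in the face \<open>E\<close>
  spanned by the remaining vertices (an edge, for a tetrahedron); the first of
  them contains \<open>v j\<close> and the second \<open>v i\<close>. At every interior point of \<open>E\<close>, the
  tangent direction orthogonal to \<open>E\<close> and pointing into one of these faces is the component of
  \<open>v j\<close>, respectively \<open>v i\<close>, orthogonal to the span of \<open>E\<close>. The interior dihedral angle is the
  angle between these two directions.
\<close>

definition dihedral_angle :: "('n::finite \<Rightarrow> real ^ 'n) \<Rightarrow> 'n \<Rightarrow> 'n \<Rightarrow> real" where
  "dihedral_angle v i j =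
     vec_angle (orth_component (v ` (- {i, j})) (v j)) (orth_component (v ` (- {i, j})) (v i))"

end

theory Submission
  imports Defs
begin

text \<open>
  The volume is computed directly, without Schlaefli's differential formula. The barycentric
  subdivision cuts the tetrahedron into 24 congruent orthoschemes
  (\<open>sector_piece_isometric\<close>, \<open>measure_cone_eq_24_orthoscheme_sectors\<close>). In the gnomonic
  chart at its centre, such an orthoscheme is the Euclidean one given by \<open>0 \<le> z \<le> sqrt 3 y\<close>,
  \<open>y \<le> sqrt 2 x\<close>, \<open>x \<le> h\<close>, where \<open>h\<close> is the tangent of the radius of the inscribed sphere,
  and the spherical volume has the density \<open>1 / (1 + x\<^sup>2 + y\<^sup>2 + z\<^sup>2)\<^sup>2\<close>
  (\<open>emeasure_solid_sector_over_chart\<close>).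

  The point of these coordinates is that \<open>h\<close>, the only parameter of the family of all
  regular tetrahedra, enters only as the upper limit of the outer integral. The
  integral over the slice at distance \<open>x\<close> is elementary
  (\<open>nn_integral_right_triangle\<close>): it is an algebraic function of \<open>x\<close> times the arctangent of
  \<open>sqrt 6 x / sqrt (1 + 3 x\<^sup>2)\<close>. This arctangent is half the edge length of the
  tetrahedron with inscribed radius \<open>arctan x\<close>, and together with the number of
  pieces the algebraic factor is six times the derivative of the dihedral angle with respect to
  \<open>x\<close>. Hence the outer integral is three times the edge length integrated against the dihedral
  angle, and the two formulae arise by taking the dihedral angle
  (\<open>integral_over_dihedral\<close>) or the edge length (\<open>integral_over_edge_length\<close>) as the variable.
\<close>

section \<open>Solid angles in the gnomonic chart\<close>

lemma nn_integral_scaleR: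
  fixes f :: "'a::euclidean_space \<Rightarrow> ennreal"
  assumes [measurable]: "f \<in> borel_measurable borel" and c: "c > 0"
  shows "(\<integral>\<^sup>+x. f x \<partial>lborel) = ennreal (c ^ DIM('a)) * (\<integral>\<^sup>+x. f (c *\<^sub>R x) \<partial>lborel)"
  using c by (subst lborel_affine[of c 0])
    (simp_all add: nn_integral_density nn_integral_distr nn_integral_cmult)

lemma vector_4:
  "(vector [s, x, y, z] :: 'a::zero ^ 4) $ 1 = s"
  "(vector [s, x, y, z] :: 'a::zero ^ 4) $ 2 = x"
  "(vector [s, x, y, z] :: 'a::zero ^ 4) $ 3 = y"
  "(vector [s, x, y, z] :: 'a::zero ^ 4) $ 4 = z"
  unfolding vector_def by simp_all

lemma emeasure_lborel_Times:
  fixes S :: "'a::euclidean_space set" and T :: "'b::euclidean_space set"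
  assumes "S \<in> sets borel" "T \<in> sets borel"
  shows "emeasure lborel (S \<times> T) = emeasure lborel S * emeasure lborel T"
  using assms by (simp add: lborel_prod[symmetric] lborel.emeasure_pair_measure_Times)

lemma measurable_vector_4:
  "(\<lambda>(s, x, y, z). vector [s, x, y, z] :: real ^ 4) \<in> borel_measurable borel"
proof -
  let ?g = "\<lambda>(s, x, y, z). vector [s, x, y, z] :: real ^ 4"
  have "continuous_on UNIV (\<lambda>p. ?g p $ i)" for i
    using exhaust_4[of i]
    by (elim disjE) (simp_all add: case_prod_unfold vector_4 continuous_intros)
  then have "continuous_on UNIV ?g"
    unfolding continuous_on_componentwise[of UNIV ?g] Basis_vec_def
    by (auto simp: inner_axis)
  then show ?thesis
    by (rule borel_measurable_continuous_onI)
qed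

text \<open>
  Iterated integration is available for products of two measures, so the four coordinates are
  separated by pulling Lebesgue measure back to nested pairs.
\<close>

lemma lborel_vector_4:
  "(lborel :: (real ^ 4) measure) =
     distr (lborel :: (real \<times> real \<times> real \<times> real) measure) borel
       (\<lambda>(s, x, y, z). vector [s, x, y, z])"
proof (rule lborel_eqI)
  let ?g = "\<lambda>(s, x, y, z). vector [s, x, y, z] :: real ^ 4"
  note measurable_vector_4[measurable]
  fix l u :: "real ^ 4" assume le: "\<And>b. b \<in> Basis \<Longrightarrow> l \<bullet> b \<le> u \<bullet> b"
  have le': "l $ i \<le> u $ i" for i
    using le[of "axis i 1"] by (simp add: inner_axis)
  have "?g -` box l u =
      {l $ 1<..<u $ 1} \<times> {l $ 2<..<u $ 2} \<times> {l $ 3<..<u $ 3} \<times> {l $ 4<..<u $ 4}"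
    by (auto simp: mem_box_cart forall_4 vector_4)
  then have "emeasure (distr lborel borel ?g) (box l u) = ennreal (u $ 1 - l $ 1) *
      (ennreal (u $ 2 - l $ 2) * (ennreal (u $ 3 - l $ 3) * ennreal (u $ 4 - l $ 4)))"
    by (simp add: emeasure_distr emeasure_lborel_Times le' borel_open open_Times)
  also have "\<dots> = ennreal (\<Prod>i\<in>UNIV. u $ i - l $ i)"
    unfolding UNIV_4 by (simp add: ennreal_mult le' mult.assoc)
  also have "(\<Prod>i\<in>UNIV. u $ i - l $ i) = (\<Prod>b\<in>Basis. (u - l) \<bullet> b)"
  proof -
    have Basis_eq: "(Basis :: (real ^ 4) set) = range (\<lambda>i. axis i 1)"
      by (auto simp: Basis_vec_def)
    have "inj (\<lambda>i. axis i 1 :: real ^ 4)"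
      by (auto simp: inj_on_def axis_eq_axis)
    from prod.reindex[OF this, of "\<lambda>b. (u - l) \<bullet> b"] show ?thesis
      by (simp add: Basis_eq inner_axis)
  qed
  finally show "emeasure (distr lborel borel ?g) (box l u) = (\<Prod>b\<in>Basis. (u - l) \<bullet> b)"
    by simp
qed simp

text \<open>
  The gnomonic projection \<open>(s, q) \<mapsto> q / s\<close> identifies the upper half-sphere with a hyperplane. Over the
  point \<open>q\<close> of the chart the unit ball has height \<open>1 / sqrt (1 + \<bar>q\<bar>\<^sup>2)\<close>, and a slice at height \<open>s\<close>
  is scaled by \<open>s ^ n\<close>; integrating \<open>s ^ n\<close> up to that height gives the spherical density of the
  chart, divided by the dimension \<open>n + 1\<close> of the ambient space.
\<close>

lemma emeasure_solid_sector_over_chart: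
  fixes P :: "'a::euclidean_space set"
  assumes [measurable]: "P \<in> sets borel"
  shows "emeasure lborel {(s, q). 0 < s \<and> q /\<^sub>R s \<in> P \<and> norm (s, q) \<le> 1} =
    (\<integral>\<^sup>+q. ennreal (1 / (real (DIM('a) + 1) * sqrt (1 + (norm q)\<^sup>2) ^ (DIM('a) + 1))) * indicator P q \<partial>lborel)"
proof -
  let ?n = "DIM('a)"
  let ?W = "{(s, q). 0 < s \<and> q /\<^sub>R s \<in> P \<and> norm (s, q) \<le> 1} :: (real \<times> 'a) set"
  have [measurable]: "?W \<in> sets (lborel \<Otimes>\<^sub>M lborel)" 
  proof -
    have "{x \<in> space (borel \<Otimes>\<^sub>M borel). 0 < fst x \<and> snd x /\<^sub>R fst x \<in> P \<and>
        sqrt ((norm (fst x))\<^sup>2 + (norm (snd x))\<^sup>2) \<le> 1} \<in> sets (borel \<Otimes>\<^sub>M (borel :: 'a measure))"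
      by measurable
    then show ?thesis
      by (simp add: space_pair_measure case_prod_unfold norm_prod_def)
  qed
  have scaled: "indicator ?W (s, s *\<^sub>R q) =
      (indicator P q * indicator {0<..1 / sqrt (1 + (norm q)\<^sup>2)} s :: ennreal)" for s and q :: 'a
  proof -
    have pos: "0 < 1 + (norm q)\<^sup>2" by (smt (verit) zero_le_power2)
    have "norm (s, s *\<^sub>R q) = s * sqrt (1 + (norm q)\<^sup>2)" if "0 < s"
    proof -
      have "norm (s, s *\<^sub>R q) = sqrt (s\<^sup>2 * (1 + (norm q)\<^sup>2))"
        using that by (simp add: norm_Pair power_mult_distrib algebra_simps)
      then show ?thesis using that by (simp add: real_sqrt_mult)
    qed
    with pos show ?thesis
      by (auto simp: indicator_def pos_le_divide_eq)
  qed
  have "emeasure lborel ?W = (\<integral>\<^sup>+s. \<integral>\<^sup>+q. indicator ?W (s, q) \<partial>lborel \<partial>lborel)"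
    by (subst lborel_prod[symmetric]) (rule lborel.emeasure_pair_measure, fact)
  \<comment> \<open>Once the slice at height \<open>s\<close> is scaled back to the chart, the only constraint on \<open>s\<close> is an
      upper bound that depends on \<open>q\<close>, so that \<open>s\<close> can be integrated first.\<close>
  also have "\<dots> = (\<integral>\<^sup>+s. \<integral>\<^sup>+q. ennreal (s ^ ?n) * (indicator P q * indicator {0<..1 / sqrt (1 + (norm q)\<^sup>2)} s)
       \<partial>lborel \<partial>lborel)"
  proof (rule nn_integral_cong)
    fix s :: real
    show "(\<integral>\<^sup>+q. indicator ?W (s, q) \<partial>lborel) =
      (\<integral>\<^sup>+q. ennreal (s ^ ?n) * (indicator P q * indicator {0<..1 / sqrt (1 + (norm q)\<^sup>2)} s) \<partial>lborel)"
    proof (cases "0 < s")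
      case True
      have "Measurable.pred borel (\<lambda>q::'a. 0 < s \<and> s \<le> 1 / sqrt (1 + (norm q)\<^sup>2))"
        by measurable
      then have [measurable]: "Measurable.pred borel (\<lambda>q::'a. s \<in> {0<..1 / sqrt (1 + (norm q)\<^sup>2)})"
        by simp
      show ?thesis
        using True by (subst nn_integral_scaleR[of _ s]) (simp_all add: scaled nn_integral_cmult)
    qed (simp add: indicator_def)
  qed
  also have "\<dots> = (\<integral>\<^sup>+q. \<integral>\<^sup>+s. ennreal (s ^ ?n) * (indicator P q * indicator {0<..1 / sqrt (1 + (norm q)\<^sup>2)} s)
       \<partial>lborel \<partial>lborel)"
  proof (rule lborel_pair.Fubini')
    have "Measurable.pred (borel \<Otimes>\<^sub>M borel)
        (\<lambda>p::'a \<times> real. 0 < snd p \<and> snd p \<le> 1 / sqrt (1 + (norm (fst p))\<^sup>2))"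
      by measurable
    then have [measurable]: "Measurable.pred (borel \<Otimes>\<^sub>M borel)
        (\<lambda>p::'a \<times> real. snd p \<in> {0<..1 / sqrt (1 + (norm (fst p))\<^sup>2)})"
      by simp
    show "(\<lambda>(q, s). ennreal (s ^ ?n) * (indicator P q * indicator {0<..1 / sqrt (1 + (norm q)\<^sup>2)} s))
        \<in> borel_measurable (lborel \<Otimes>\<^sub>M lborel)"
      by measurable
  qed
  also have "\<dots> = (\<integral>\<^sup>+q. ennreal (1 / (real (?n + 1) * sqrt (1 + (norm q)\<^sup>2) ^ (?n + 1))) * indicator P q \<partial>lborel)"
  proof (rule nn_integral_cong)
    fix q :: 'a
    define r where "r = 1 / sqrt (1 + (norm q)\<^sup>2)"
    have r: "0 \<le> r" by (simp add: r_def)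
    have "(\<integral>\<^sup>+s. ennreal (s ^ ?n) * (indicator P q * indicator {0<..r} s) \<partial>lborel)
        = (\<integral>\<^sup>+s. ennreal (s ^ ?n) * indicator {0..r} s * indicator P q \<partial>lborel)"
      by (intro nn_integral_cong) (auto simp: indicator_def zero_power)
    also have "\<dots> = (\<integral>\<^sup>+s. ennreal (s ^ ?n) * indicator {0..r} s \<partial>lborel) * indicator P q"
      by (rule nn_integral_multc) measurable
    also have "(\<integral>\<^sup>+s. ennreal (s ^ ?n) * indicator {0..r} s \<partial>lborel) =
        r ^ (?n + 1) / real (?n + 1) - 0 ^ (?n + 1) / real (?n + 1)"
    proof (rule nn_integral_FTC_Icc)
      fix s :: real
      show "((\<lambda>s. s ^ (?n + 1) / real (?n + 1)) has_real_derivative s ^ ?n) (at s)"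
        by (rule DERIV_cong[OF DERIV_cdivide[OF DERIV_pow]]) simp
    qed (use r in auto)
    finally show "(\<integral>\<^sup>+s. ennreal (s ^ ?n) * (indicator P q * indicator {0<..1 / sqrt (1 + (norm q)\<^sup>2)} s) \<partial>lborel)
       = ennreal (1 / (real (?n + 1) * sqrt (1 + (norm q)\<^sup>2) ^ (?n + 1))) * indicator P q"
      by (simp add: r_def power_divide divide_simps mult_ac)
  qed
  finally show ?thesis .
qed

section \<open>Integration over a slice\<close>

lemma nn_integral_over_slope:
  assumes "0 < k" "0 < d" "0 \<le> q"
  shows "(\<integral>\<^sup>+t. ennreal (d\<^sup>2 / (8 * k * (k + d\<^sup>2 * (1 + t\<^sup>2)))) * indicator {0..q} t \<partial>lborel) =
    ennreal (d / (8 * k * sqrt (k + d\<^sup>2)) * arctan (d * q / sqrt (k + d\<^sup>2)))"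
proof -
  define m where "m = sqrt (k + d\<^sup>2)"
  have m: "m > 0" "k + d\<^sup>2 = m\<^sup>2" using assms by (simp_all add: m_def add_pos_nonneg)
  have pos: "0 < k + d\<^sup>2 * (1 + t\<^sup>2)" for t
    using assms by (simp add: add_pos_nonneg)
  have "(\<integral>\<^sup>+t. ennreal (d\<^sup>2 / (8 * k * (k + d\<^sup>2 * (1 + t\<^sup>2)))) * indicator {0..q} t \<partial>lborel) =
     ennreal (d / (8 * k * m) * arctan (d * q / m) - d / (8 * k * m) * arctan (d * 0 / m))"
  proof (rule nn_integral_FTC_Icc)
    fix t
    define E where "E = 1 + (d * t / m)\<^sup>2"
    have E: "k + d\<^sup>2 * (1 + t\<^sup>2) = m\<^sup>2 * E"
      using m by (simp add: E_def power_divide power_mult_distrib algebra_simps)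
    have "d / (8 * k * m) * (inverse E * (d / m)) = d\<^sup>2 / (8 * k * (m\<^sup>2 * E))"
      by (simp add: field_simps power2_eq_square)
    then have "d / (8 * k * m) * (inverse (1 + (d * t / m)\<^sup>2) * (d / m)) = d\<^sup>2 / (8 * k * (k + d\<^sup>2 * (1 + t\<^sup>2)))"
      unfolding E E_def .
    moreover have "((\<lambda>t. d * t / m) has_real_derivative d / m) (at t)"
      using DERIV_cdivide[OF DERIV_cmult_Id] .
    then have "((\<lambda>t. d / (8 * k * m) * arctan (d * t / m)) has_real_derivative
        d / (8 * k * m) * (inverse (1 + (d * t / m)\<^sup>2) * (d / m))) (at t)"
      by (intro DERIV_cmult DERIV_chain2[OF DERIV_arctan])
    ultimately show "((\<lambda>t. d / (8 * k * m) * arctan (d * t / m)) has_real_derivative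
       d\<^sup>2 / (8 * k * (k + d\<^sup>2 * (1 + t\<^sup>2)))) (at t)"
      by simp
    show "0 \<le> d\<^sup>2 / (8 * k * (k + d\<^sup>2 * (1 + t\<^sup>2)))"
      using assms pos[of t] by simp
  qed (use assms in auto)
  then show ?thesis by (simp add: m_def)
qed

lemma nn_integral_along_leg:
  assumes "0 < k" "0 \<le> d"
  shows "(\<integral>\<^sup>+y. ennreal (y / (4 * (k + y\<^sup>2 * (1 + t\<^sup>2))\<^sup>2)) * indicator {0..d} y \<partial>lborel) =
    ennreal (d\<^sup>2 / (8 * k * (k + d\<^sup>2 * (1 + t\<^sup>2))))"
proof -
  define e where "e = 1 + t\<^sup>2"
  have e: "0 < e" unfolding e_def by (smt (verit) zero_le_power2)
  have pos: "0 < k + y\<^sup>2 * e" for y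
    using assms e by (simp add: add_pos_nonneg)
  have "(\<integral>\<^sup>+y. ennreal (y / (4 * (k + y\<^sup>2 * e)\<^sup>2)) * indicator {0..d} y \<partial>lborel) =
     ennreal (- 1 / (8 * e) * inverse (k + d\<^sup>2 * e) - - 1 / (8 * e) * inverse (k + 0\<^sup>2 * e))"
  proof (rule nn_integral_FTC_Icc)
    fix y assume y: "y \<in> {0..d}"
    define u where "u = k + y\<^sup>2 * e"
    have "((\<lambda>y. k + y\<^sup>2 * e) has_real_derivative 2 * y * e) (at y)"
      by (auto intro!: derivative_eq_intros)
    then have "((\<lambda>y. - 1 / (8 * e) * inverse (k + y\<^sup>2 * e)) has_real_derivative
        - 1 / (8 * e) * - (inverse u * (2 * y * e) * inverse u)) (at y)"
      unfolding u_def by (intro DERIV_cmult DERIV_inverse') (use pos[of y] in auto)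
    moreover have "- 1 / (8 * e) * - (inverse u * (2 * y * e) * inverse u) = y / (4 * u\<^sup>2)"
      using e by (simp add: field_simps power2_eq_square)
    ultimately show "((\<lambda>y. - 1 / (8 * e) * inverse (k + y\<^sup>2 * e)) has_real_derivative
        y / (4 * (k + y\<^sup>2 * e)\<^sup>2)) (at y)"
      by (simp add: u_def)
    show "0 \<le> y / (4 * (k + y\<^sup>2 * e)\<^sup>2)" using y by simp
  qed (use assms in auto)
  also have "- 1 / (8 * e) * inverse (k + d\<^sup>2 * e) - - 1 / (8 * e) * inverse (k + 0\<^sup>2 * e) =
      d\<^sup>2 / (8 * k * (k + d\<^sup>2 * e))"
  proof -
    define u where "u = k + d\<^sup>2 * e"
    have "0 < u" using pos[of d] by (simp add: u_def)
    then have "- 1 / (8 * e) * inverse u - - 1 / (8 * e) * inverse k = (u - k) / (8 * e * k * u)"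
      using e assms(1) by (simp add: field_simps)
    also have "\<dots> = d\<^sup>2 / (8 * k * u)"
      using e by (simp add: u_def)
    finally show ?thesis by (simp add: u_def)
  qed
  finally show ?thesis by (simp add: e_def)
qed

text \<open>
  The density is integrated over the right triangle with legs \<open>d\<close> and \<open>q d\<close>. The slope
  \<open>t = z / y\<close> is kept for last: for fixed slope the integrand in \<open>y\<close> has a rational primitive,
  and what it leaves behind is the derivative of an arctangent in \<open>t\<close>, whereas integrating in
  \<open>z\<close> first produces arctangents of algebraic functions.
\<close>

lemma nn_integral_right_triangle:
  assumes k: "0 < k" and d: "0 \<le> d" and q: "0 \<le> q"
  shows "(\<integral>\<^sup>+y. \<integral>\<^sup>+z. ennreal (1 / (4 * (k + y\<^sup>2 + z\<^sup>2)\<^sup>2)) * (indicator {0..d} y * indicator {0..q * y} z)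
       \<partial>lborel \<partial>lborel) =
    ennreal (d / (8 * k * sqrt (k + d\<^sup>2)) * arctan (d * q / sqrt (k + d\<^sup>2)))"
proof (cases "d = 0")
  case True
  have "AE y in lborel. (\<integral>\<^sup>+z. ennreal (1 / (4 * (k + y\<^sup>2 + z\<^sup>2)\<^sup>2)) *
          (indicator {0..d} y * indicator {0..q * y} z) \<partial>lborel) = 0"
    using AE_lborel_singleton[of "0::real"] by eventually_elim (simp add: True)
  then have "(\<integral>\<^sup>+y. \<integral>\<^sup>+z. ennreal (1 / (4 * (k + y\<^sup>2 + z\<^sup>2)\<^sup>2)) *
          (indicator {0..d} y * indicator {0..q * y} z) \<partial>lborel \<partial>lborel) = (\<integral>\<^sup>+(y::real). 0 \<partial>lborel)"
    by (rule nn_integral_cong_AE)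
  then show ?thesis using True by simp
next
  case False
  with d have d: "0 < d" by simp
  \<comment> \<open>Substitution \<open>z = y t\<close>; it degenerates on the null set \<open>y = 0\<close>.\<close>
  have "AE y in lborel. (\<integral>\<^sup>+z. ennreal (1 / (4 * (k + y\<^sup>2 + z\<^sup>2)\<^sup>2)) *
          (indicator {0..d} y * indicator {0..q * y} z) \<partial>lborel) =
       (\<integral>\<^sup>+t. ennreal (y / (4 * (k + y\<^sup>2 * (1 + t\<^sup>2))\<^sup>2)) * (indicator {0..d} y * indicator {0..q} t) \<partial>lborel)"
    using AE_lborel_singleton[of "0::real"]
  proof eventually_elim
    fix y :: real assume "y \<noteq> 0"
    then consider "y < 0" | "0 < y" by linarith
    then show "(\<integral>\<^sup>+z. ennreal (1 / (4 * (k + y\<^sup>2 + z\<^sup>2)\<^sup>2)) *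
          (indicator {0..d} y * indicator {0..q * y} z) \<partial>lborel) =
       (\<integral>\<^sup>+t. ennreal (y / (4 * (k + y\<^sup>2 * (1 + t\<^sup>2))\<^sup>2)) * (indicator {0..d} y * indicator {0..q} t) \<partial>lborel)"
    proof cases
      case 2
      have ind: "(indicator {0..q * y} (y * t) :: ennreal) = indicator {0..q} t" for t
        using 2 by (auto simp: indicator_def zero_le_mult_iff mult.commute[of q])
      have "(\<integral>\<^sup>+z. ennreal (1 / (4 * (k + y\<^sup>2 + z\<^sup>2)\<^sup>2)) *
          (indicator {0..d} y * indicator {0..q * y} z) \<partial>lborel) =
        ennreal y * (\<integral>\<^sup>+t. ennreal (1 / (4 * (k + y\<^sup>2 + (y * t)\<^sup>2)\<^sup>2)) *
          (indicator {0..d} y * indicator {0..q * y} (y * t)) \<partial>lborel)"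
        using 2 by (subst nn_integral_real_affine[where c=y and t=0]) simp_all
      also have "\<dots> = (\<integral>\<^sup>+t. ennreal y * (ennreal (1 / (4 * (k + y\<^sup>2 + (y * t)\<^sup>2)\<^sup>2)) *
          (indicator {0..d} y * indicator {0..q * y} (y * t))) \<partial>lborel)"
        by (rule nn_integral_cmult[symmetric]) measurable
      also have "\<dots> = (\<integral>\<^sup>+t. ennreal (y / (4 * (k + y\<^sup>2 * (1 + t\<^sup>2))\<^sup>2)) * (indicator {0..d} y * indicator {0..q} t) \<partial>lborel)"
        using 2 unfolding ind mult.assoc[symmetric]
        by (intro nn_integral_cong) (simp add: ennreal_mult[symmetric] power_mult_distrib algebra_simps)
      finally show ?thesis .
    qed simp
  qed
  then have "(\<integral>\<^sup>+y. \<integral>\<^sup>+z. ennreal (1 / (4 * (k + y\<^sup>2 + z\<^sup>2)\<^sup>2)) *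
          (indicator {0..d} y * indicator {0..q * y} z) \<partial>lborel \<partial>lborel) =
      (\<integral>\<^sup>+y. \<integral>\<^sup>+t. ennreal (y / (4 * (k + y\<^sup>2 * (1 + t\<^sup>2))\<^sup>2)) * (indicator {0..d} y * indicator {0..q} t) \<partial>lborel \<partial>lborel)"
    by (rule nn_integral_cong_AE)
  also have "\<dots> = (\<integral>\<^sup>+t. \<integral>\<^sup>+y. ennreal (y / (4 * (k + y\<^sup>2 * (1 + t\<^sup>2))\<^sup>2)) * (indicator {0..d} y * indicator {0..q} t) \<partial>lborel \<partial>lborel)"
    by (rule lborel_pair.Fubini') measurable
  also have "\<dots> = (\<integral>\<^sup>+t. (\<integral>\<^sup>+y. ennreal (y / (4 * (k + y\<^sup>2 * (1 + t\<^sup>2))\<^sup>2)) * indicator {0..d} y \<partial>lborel) * indicator {0..q} t \<partial>lborel)"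
    by (subst nn_integral_multc[symmetric]) (simp_all add: mult.assoc)
  also have "\<dots> = ennreal (d / (8 * k * sqrt (k + d\<^sup>2)) * arctan (d * q / sqrt (k + d\<^sup>2)))"
    using k d q by (simp add: nn_integral_along_leg nn_integral_over_slope)
  finally show ?thesis .
qed

section \<open>Spherical orthoschemes\<close>

text \<open>
  The part of the unit ball over a spherical orthoscheme, in orthonormal coordinates adapted to its
  flag of faces. In the gnomonic chart it is the Euclidean orthoscheme with legs \<open>h\<close>, \<open>p h\<close>
  and \<open>q p h\<close>.
\<close>

definition orthoscheme_sector :: "real \<Rightarrow> real \<Rightarrow> real \<Rightarrow> (real ^ 4) set" where
  "orthoscheme_sector h p q =
     {w. 0 \<le> w $ 4 \<and> w $ 4 \<le> q * w $ 3 \<and> w $ 3 \<le> p * w $ 2 \<and> w $ 2 \<le> h * w $ 1 \<and> norm w \<le> 1}"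

lemma compact_orthoscheme_sector: "compact (orthoscheme_sector h p q)"
proof -
  have "closed (orthoscheme_sector h p q)"
    unfolding orthoscheme_sector_def
    by (intro closed_Collect_conj closed_Collect_le continuous_intros)
  moreover have "orthoscheme_sector h p q \<subseteq> cball 0 1"
    by (auto simp: orthoscheme_sector_def)
  ultimately show ?thesis
    by (meson bounded_cball bounded_subset compact_eq_bounded_closed)
qed

text \<open>
  The integral of \<open>1 / (4 (1 + x\<^sup>2 + y\<^sup>2 + z\<^sup>2)\<^sup>2)\<close> over the slice \<open>0 \<le> y \<le> p x\<close>,
  \<open>0 \<le> z \<le> q y\<close> of the chart at distance \<open>x\<close>.
\<close>

definition orthoscheme_density :: "real \<Rightarrow> real \<Rightarrow> real \<Rightarrow> real" where
  "orthoscheme_density p q x =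
     p * x / (8 * (1 + x\<^sup>2) * sqrt (1 + x\<^sup>2 + (p * x)\<^sup>2)) * arctan (p * x * q / sqrt (1 + x\<^sup>2 + (p * x)\<^sup>2))"

lemma emeasure_orthoscheme_sector:
  assumes h: "0 < h" and p: "0 < p" and q: "0 < q"
  shows "emeasure lborel (orthoscheme_sector h p q) =
     (\<integral>\<^sup>+x. ennreal (orthoscheme_density p q x) * indicator {0..h} x \<partial>lborel)"
proof -
  let ?P = "{(x, y, z). 0 \<le> z \<and> z \<le> q * y \<and> y \<le> p * x \<and> x \<le> h}"
  let ?W = "{(s, r). 0 < s \<and> r /\<^sub>R s \<in> ?P \<and> norm (s, r) \<le> 1}"
  let ?g = "\<lambda>(s, x, y, z). vector [s, x, y, z] :: real ^ 4"
  have meas[measurable]: "?g \<in> borel_measurable borel"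
    by (rule measurable_vector_4)
  have "closed ?P"
    unfolding case_prod_unfold
    by (intro closed_Collect_conj closed_Collect_le continuous_intros)
  then have P[measurable]: "?P \<in> sets borel" by (rule borel_closed)
  have norm_vec: "norm (?g (s, x, y, z)) = norm (s, x, y, z)" for s x y z
    by (simp add: norm_vec_def L2_set_def sum_4 vector_4 norm_Pair)
  \<comment> \<open>The only point at height \<open>s \<le> 0\<close> is the apex, because the inequalities force every coordinate,
      in turn, to be nonnegative.\<close>
  have pre: "?g -` orthoscheme_sector h p q = ?W \<union> {0}"
  proof -
    have "(s, x, y, z) \<in> ?g -` orthoscheme_sector h p q \<longleftrightarrow> (s, x, y, z) \<in> ?W \<union> {0}" for s x y z
    proof (cases "0 < s")
      case True
      then show ?thesis
        unfolding vimage_eq orthoscheme_sector_def mem_Collect_eq norm_vec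
        by (auto simp: vector_4 field_simps zero_prod_def)
    next
      case False
      have "s = 0 \<and> x = 0 \<and> y = 0 \<and> z = 0" if "0 \<le> z" "z \<le> q * y" "y \<le> p * x" "x \<le> h * s"
      proof -
        have "0 \<le> q * y" using that by linarith
        then have "0 \<le> y" using q by (simp add: zero_le_mult_iff)
        then have "0 \<le> p * x" using that by linarith
        then have "0 \<le> x" using p by (simp add: zero_le_mult_iff)
        then have "0 \<le> h * s" using that by linarith
        then have "0 \<le> s" using h by (simp add: zero_le_mult_iff)
        with False have "s = 0" by simp
        with that \<open>0 \<le> x\<close> have "x = 0" by simp
        with that \<open>0 \<le> y\<close> have "y = 0" by simp
        with that \<open>s = 0\<close> \<open>x = 0\<close> show ?thesis by simp
      qed
      with False show ?thesis
        unfolding vimage_eq orthoscheme_sector_def mem_Collect_eq norm_vec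
        by (auto simp: vector_4 zero_prod_def)
    qed
    then show ?thesis by auto
  qed
  have sector: "orthoscheme_sector h p q \<in> sets borel"
    by (intro borel_compact compact_orthoscheme_sector)
  have "emeasure lborel (orthoscheme_sector h p q) = emeasure lborel (?W \<union> {0})"
    by (subst lborel_vector_4) (simp add: emeasure_distr sector meas pre)
  also have "\<dots> = emeasure lborel ?W"
  proof (rule emeasure_Un_null_set)
    have "?W \<union> {0} \<in> sets borel"
      using measurable_sets[OF meas sector] by (simp add: pre)
    then have "?W \<union> {0} - {0} \<in> sets borel" by (rule sets.Diff) (simp add: borel_closed)
    moreover have "?W \<union> {0} - {0} = ?W" by (auto simp: zero_prod_def)
    ultimately show "?W \<in> sets lborel" by simp
    show "{0} \<in> null_sets (lborel :: (real \<times> real \<times> real \<times> real) measure)"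
      by (simp add: null_sets_def)
  qed
  also have "\<dots> = (\<integral>\<^sup>+r. ennreal (1 / (4 * (1 + (norm r)\<^sup>2)\<^sup>2)) * indicator ?P r \<partial>lborel)"
  proof -
    have dim: "DIM(real \<times> real \<times> real) + 1 = 4" by simp
    have "sqrt (1 + (norm r)\<^sup>2) ^ 4 = (1 + (norm r)\<^sup>2)\<^sup>2" for r :: "real \<times> real \<times> real"
      using power_mult[of "sqrt (1 + (norm r)\<^sup>2)" 2 2] by simp
    then show ?thesis
      unfolding emeasure_solid_sector_over_chart[OF P] dim by simp
  qed
  also have "\<dots> = (\<integral>\<^sup>+x. \<integral>\<^sup>+y. \<integral>\<^sup>+z. ennreal (1 / (4 * (1 + (norm (x, y, z))\<^sup>2)\<^sup>2)) * indicator ?P (x, y, z)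
      \<partial>lborel \<partial>lborel \<partial>lborel)"
  proof -
    let ?f = "\<lambda>r. ennreal (1 / (4 * (1 + (norm r)\<^sup>2)\<^sup>2)) * indicator ?P r"
    have f: "?f \<in> borel_measurable (lborel \<Otimes>\<^sub>M lborel)"
      unfolding lborel_prod by measurable
    have "(\<lambda>r. ?f (x, r)) \<in> borel_measurable (lborel \<Otimes>\<^sub>M lborel)" for x
      unfolding lborel_prod by measurable
    from lborel.nn_integral_fst[OF this] show ?thesis
      by (simp add: lborel.nn_integral_fst[OF f, symmetric, unfolded lborel_prod] lborel_prod)
  qed
  also have "\<dots> = (\<integral>\<^sup>+x. ennreal (orthoscheme_density p q x) * indicator {0..h} x \<partial>lborel)"
  proof (rule nn_integral_cong)
    fix x :: real
    have ind: "(indicator ?P (x, y, z) :: ennreal) =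
        indicator {0..h} x * (indicator {0..p * x} y * indicator {0..q * y} z)" for y z
      using p q by (auto simp: indicator_def zero_le_mult_iff)
        (smt (verit) mult_pos_neg)+
    show "(\<integral>\<^sup>+y. \<integral>\<^sup>+z. ennreal (1 / (4 * (1 + (norm (x, y, z))\<^sup>2)\<^sup>2)) * indicator ?P (x, y, z) \<partial>lborel \<partial>lborel)
        = ennreal (orthoscheme_density p q x) * indicator {0..h} x"
    proof (cases "x \<in> {0..h}")
      case True
      then have "0 \<le> p * x" using p by simp
      moreover have "0 < 1 + x\<^sup>2" by (smt (verit) zero_le_power2)
      ultimately show ?thesis
        using nn_integral_right_triangle[of "1 + x\<^sup>2" "p * x" q] True q
        unfolding ind by (simp add: norm_Pair orthoscheme_density_def add.assoc)
    qed (simp add: ind)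
  qed
  finally show ?thesis .
qed

lemma measure_orthoscheme_sector:
  assumes h: "0 < h" and p: "0 < p" and q: "0 < q"
  shows "measure lebesgue (orthoscheme_sector h p q) = (LBINT x=0..h. orthoscheme_density p q x)"
proof -
  have nonneg: "0 \<le> orthoscheme_density p q x" if "0 \<le> x" for x
    using that p q unfolding orthoscheme_density_def
    by (intro mult_nonneg_nonneg divide_nonneg_nonneg) (auto simp: zero_le_arctan_iff)
  have pos: "0 < 1 + x\<^sup>2" "0 < 1 + x\<^sup>2 + (p * x)\<^sup>2" for x
    by (smt (verit) zero_le_power2)+
  have "continuous_on {0..h} (orthoscheme_density p q)"
    unfolding orthoscheme_density_def using pos
    by (intro continuous_intros) (metis less_numeral_extra(3) mult_eq_0_iff real_sqrt_eq_zero_cancel_iff zero_neq_numeral)+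
  then have int: "set_integrable lborel {0..h} (orthoscheme_density p q)"
    by (rule borel_integrable_atLeastAtMost')
  have "emeasure lborel (orthoscheme_sector h p q) =
      (\<integral>\<^sup>+x. ennreal (indicator {0..h} x * orthoscheme_density p q x) \<partial>lborel)"
    unfolding emeasure_orthoscheme_sector[OF assms]
    by (intro nn_integral_cong) (simp add: indicator_def)
  also have "\<dots> = ennreal (\<integral>x. indicator {0..h} x * orthoscheme_density p q x \<partial>lborel)"
    using int nonneg
    by (intro nn_integral_eq_integral) (auto simp: set_integrable_def indicator_def)
  also have "(\<integral>x. indicator {0..h} x * orthoscheme_density p q x \<partial>lborel) =
      (LBINT x=0..h. orthoscheme_density p q x)"
    using h interval_integral_Icc[of 0 h "orthoscheme_density p q"]
    by (simp add: set_lebesgue_integral_def zero_ereal_def)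
  finally have em: "emeasure lborel (orthoscheme_sector h p q) = ennreal (LBINT x=0..h. orthoscheme_density p q x)" .
  moreover have "0 \<le> (LBINT x=0..h. orthoscheme_density p q x)"
    using h nonneg interval_integral_Icc[of 0 h "orthoscheme_density p q"]
    by (auto simp: set_lebesgue_integral_def zero_ereal_def indicator_def intro!: integral_nonneg)
  moreover have "measure lebesgue (orthoscheme_sector h p q) = measure lborel (orthoscheme_sector h p q)"
    by (intro measure_completion) (simp add: borel_compact compact_orthoscheme_sector)
  ultimately show ?thesis by (simp add: measure_def)
qed

section \<open>Barycentric subdivision of a regular tetrahedron\<close>

lemma orth_component_eqI:
  assumes "z \<in> span B" and "\<And>b. b \<in> B \<Longrightarrow> (x - z) \<bullet> b = 0"
  shows "orth_component B x = x - z"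
proof -
  have "dist x z \<le> dist x y" if "y \<in> span B" for y
  proof -
    have "z - y \<in> span B" using assms(1) that by (rule span_diff)
    then have "orthogonal (x - z) (z - y)"
      using assms(2) orthogonal_to_span[of "z - y" B "x - z"] by (auto simp: orthogonal_def)
    from norm_add_Pythagorean[OF this] have "(norm (x - z))\<^sup>2 \<le> (norm (x - y))\<^sup>2"
      by simp
    then show ?thesis by (simp add: dist_norm)
  qed
  then have "z = closest_point (span B) x"
    using assms(1) by (intro closest_point_unique subspace_imp_convex subspace_span closed_span) auto
  then show ?thesis by (simp add: orth_component_def)
qed

text \<open>
  The Gram matrix with diagonal \<open>1\<close> and constant entry \<open>c\<close> elsewhere has the eigenvalues \<open>1 - c\<close> and
  \<open>1 + 3 c\<close>, so the two bounds on \<open>c\<close> say that the vectors are linearly independent.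
\<close>

locale equiangular_frame =
  fixes v :: "4 \<Rightarrow> real ^ 4" and c :: real
  assumes inner_same [simp]: "v i \<bullet> v i = 1"
    and inner_distinct: "i \<noteq> j \<Longrightarrow> v i \<bullet> v j = c"
    and c_less: "c < 1" and c_greater: "- 1 / 3 < c"
begin

text \<open>
  Both neighbouring vertices lose the same multiple of \<open>v k + v l\<close> when they are projected away from
  the common edge.
\<close>

lemma dihedral_angle_eq:
  assumes "i \<noteq> j"
  shows "dihedral_angle v i j = arccos (c / (1 + 2 * c))"
proof -
  have "card (- {i, j}) = 2"
    using assms by (simp add: Compl_eq_Diff_UNIV card_Diff_subset)
  then obtain k l where kl: "- {i, j} = {k, l}" "k \<noteq> l" by (auto simp: card_2_iff)
  then have ne: "k \<noteq> i" "k \<noteq> j" "l \<noteq> i" "l \<noteq> j" by auto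
  have c1: "0 < 1 + c" "0 < 1 - c" "0 < 1 + 2 * c" using c_less c_greater by auto
  define t where "t = c / (1 + c)"
  have t: "t * (1 + c) = c" using c1(1) by (simp add: t_def)
  define m where "m p = v p - t *\<^sub>R (v k + v l)" for p
  have m_inner: "m p \<bullet> b = 0" if "p \<noteq> k" "p \<noteq> l" "b \<in> {v k, v l}" for p b
  proof -
    have "(v k + v l) \<bullet> b = 1 + c" "v p \<bullet> b = c"
      using that kl(2) by (auto simp: inner_add_left inner_distinct)
    then show ?thesis by (simp add: m_def inner_diff_left t)
  qed
  have comp: "orth_component {v k, v l} (v p) = m p" if "p \<noteq> k" "p \<noteq> l" for p
    unfolding m_def
  proof (rule orth_component_eqI)
    show "t *\<^sub>R (v k + v l) \<in> span {v k, v l}"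
      by (intro span_mul span_add span_base) auto
  qed (use m_inner that in \<open>simp add: m_def\<close>)
  have m_m: "m p \<bullet> m q = v p \<bullet> v q - 2 * t * c" if "p \<noteq> k" "p \<noteq> l" "q \<noteq> k" "q \<noteq> l" for p q
  proof -
    have "m p \<bullet> m q = m p \<bullet> v q - t * (m p \<bullet> v k + m p \<bullet> v l)"
      by (simp add: m_def[of q] inner_diff_right inner_add_right)
    also have "\<dots> = m p \<bullet> v q" using m_inner[OF that(1,2)] by simp
    also have "\<dots> = v p \<bullet> v q - 2 * t * c"
      using that by (simp add: m_def inner_diff_left inner_add_left inner_distinct)
    finally show ?thesis .
  qed
  have mm: "m i \<bullet> m j = c * (1 - c) / (1 + c)" "m p \<bullet> m p = (1 - c) * (1 + 2 * c) / (1 + c)"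
    if "p \<noteq> k" "p \<noteq> l" for p
  proof -
    have "c - 2 * t * c = c * (1 - c) / (1 + c)" "1 - 2 * t * c = (1 - c) * (1 + 2 * c) / (1 + c)"
      unfolding t_def using c1(1) by (simp_all add: field_simps)
    then show "m i \<bullet> m j = c * (1 - c) / (1 + c)" "m p \<bullet> m p = (1 - c) * (1 + 2 * c) / (1 + c)"
      using assms ne that by (simp_all add: m_m inner_distinct)
  qed
  have "norm (m i) * norm (m j) = (1 - c) * (1 + 2 * c) / (1 + c)"
    using mm(2)[of i] mm(2)[of j] ne c1
    by (simp add: norm_eq_sqrt_inner flip: real_sqrt_mult)
  then have "(m j \<bullet> m i) / (norm (m j) * norm (m i)) = c / (1 + 2 * c)"
    using mm(1)[of i] ne c1 by (simp add: inner_commute mult.commute[of "norm (m j)"])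
  then show ?thesis
    unfolding dihedral_angle_def vec_angle_def kl by (simp add: comp ne[symmetric])
qed

abbreviation combination :: "(4 \<Rightarrow> real) \<Rightarrow> real ^ 4" where
  "combination y \<equiv> (\<Sum>m\<in>UNIV. y m *\<^sub>R v m)"

lemma convex_cone_hull_range:
  "convex_cone hull (range v) = {combination y | y. \<forall>m. 0 \<le> y m}" (is "_ = ?K")
proof
  show "convex_cone hull (range v) \<subseteq> ?K"
  proof (rule hull_minimal)
    show "range v \<subseteq> ?K"
    proof clarify
      fix i
      have "v i = combination (\<lambda>m. if m = i then 1 else 0)"
        by (simp add: if_distrib[of "\<lambda>r. r *\<^sub>R _"] cong: if_cong)
      then show "\<exists>y. v i = combination y \<and> (\<forall>m. 0 \<le> y m)"
        by (intro exI[of _ "\<lambda>m. if m = i then 1 else 0"]) auto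
    qed
    show "convex_cone ?K"
      unfolding convex_cone_iff
    proof (intro conjI ballI allI impI)
      show "0 \<in> ?K" by (auto intro: exI[of _ "\<lambda>_. 0"])
    next
      fix x z assume "x \<in> ?K" "z \<in> ?K"
      then obtain y y' where "x = combination y" "\<forall>m. 0 \<le> y m" "z = combination y'" "\<forall>m. 0 \<le> y' m"
        by auto
      then show "x + z \<in> ?K"
        by (auto intro!: exI[of _ "\<lambda>m. y m + y' m"] simp: scaleR_add_left sum.distrib)
    next
      fix x and r :: real assume "x \<in> ?K" "0 \<le> r"
      then obtain y where "x = combination y" "\<forall>m. 0 \<le> y m" by auto
      with \<open>0 \<le> r\<close> show "r *\<^sub>R x \<in> ?K"
        by (auto intro!: exI[of _ "\<lambda>m. r * y m"] simp: scaleR_sum_right)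
    qed
  qed
  show "?K \<subseteq> convex_cone hull (range v)"
  proof clarify
    fix y :: "4 \<Rightarrow> real" assume "\<forall>m. 0 \<le> y m"
    then have "y m *\<^sub>R v m \<in> convex_cone hull (range v)" for m
      by (intro convex_cone_hull_mul hull_inc) auto
    then show "combination y \<in> convex_cone hull (range v)"
      unfolding sum_4 by (intro convex_cone_hull_add)
  qed
qed

lemma inner_combination: "combination y \<bullet> v i = (1 - c) * y i + c * (\<Sum>m\<in>UNIV. y m)"
proof -
  have "combination y \<bullet> v i = (\<Sum>m\<in>UNIV. y m * (if m = i then 1 else c))"
    unfolding inner_sum_left by (intro sum.cong) (auto simp: inner_distinct)
  also have "\<dots> = (\<Sum>m\<in>UNIV. c * y m + (1 - c) * (if m = i then y m else 0))"
    by (intro sum.cong) (auto simp: algebra_simps)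
  also have "\<dots> = (1 - c) * y i + c * (\<Sum>m\<in>UNIV. y m)"
    by (simp add: sum.distrib sum_distrib_left[symmetric])
  finally show ?thesis .
qed

lemma combination_eq_iff: "combination y = combination y' \<longleftrightarrow> y = y'"
proof
  assume eq: "combination y = combination y'"
  let ?S = "\<lambda>y. \<Sum>m\<in>UNIV. y m :: real"
  have inner: "(1 - c) * y i + c * ?S y = (1 - c) * y' i + c * ?S y'" for i
    using inner_combination[of y i] inner_combination[of y' i] eq by simp
  have total: "(1 + 3 * c) * ?S z = (\<Sum>i\<in>UNIV. (1 - c) * z i + c * ?S z)" for z :: "4 \<Rightarrow> real"
    by (simp add: sum_4 algebra_simps)
  have "(1 + 3 * c) * ?S y = (1 + 3 * c) * ?S y'"
    unfolding total by (simp only: inner)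
  then have "?S y = ?S y'" using c_greater by simp
  then show "y = y'" using inner c_less by (intro ext) simp
qed simp

lemma combination_in_convex_cone_hull_iff:
  "combination y \<in> convex_cone hull (range v) \<longleftrightarrow> (\<forall>m. 0 \<le> y m)"
  unfolding convex_cone_hull_range mem_Collect_eq combination_eq_iff by simp

text \<open>
  A list of all four indices stands for a chamber of the barycentric subdivision. The chambers are
  cut out by inner products with the vertices, which depend on the point alone; they compare
  in the same way as the barycentric coordinates, by \<open>inner_combination\<close>.
\<close>

definition sector_piece :: "4 list \<Rightarrow> (real ^ 4) set" where
  "sector_piece xs = {x \<in> convex_cone hull (range v). norm x \<le> 1 \<and> sorted (map (\<lambda>m. - (x \<bullet> v m)) xs)}"

text \<open>
  The centres of the tetrahedron, of a face, of an edge of this face and a vertex of this edge form a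
  flag. Because the frame is equiangular, applying the Gram-Schmidt process to it
  gives the explicit orthogonal vectors \<open>W1\<close> to \<open>W4\<close> below, and in these coordinates every chamber
  is the same orthoscheme sector.
\<close>

lemma sector_piece_isometric:
  assumes "distinct xs" "length xs = 4"
  obtains T where "orthogonal_transformation T"
    and "T ` orthoscheme_sector (sqrt ((1 - c) / (3 * (1 + 3 * c)))) (sqrt 2) (sqrt 3) = sector_piece xs"
proof -
  from assms(2) obtain i j k l where xs: "xs = [i, j, k, l]"
    by (auto simp: numeral_eq_Suc length_Suc_conv)
  with assms(1) have ne: "i \<noteq> j" "i \<noteq> k" "i \<noteq> l" "j \<noteq> k" "j \<noteq> l" "k \<noteq> l" by auto
  have "card {i, j, k, l} = CARD(4)" using ne by simp
  then have UN: "UNIV = {i, j, k, l}" by (metis card_subset_eq finite subset_UNIV)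
  have sum_UNIV: "sum f UNIV = f i + f j + f k + f l" for f :: "4 \<Rightarrow> 'b::comm_monoid_add"
    unfolding UN using ne by (simp add: add.assoc)
  have c1: "0 < 1 - c" "0 < 1 + 3 * c" using c_less c_greater by auto
  define n where "n = 2 * sqrt (1 + 3 * c)"
  define m where "m = sqrt 2 * sqrt (1 - c)"
  have n: "0 < n" "n * n = 4 * (1 + 3 * c)" and m: "0 < m" "m * m = 2 * (1 - c)"
    using c1 unfolding n_def m_def by (simp_all add: algebra_simps flip: power2_eq_square)
  define W1 W2 W3 W4 where "W1 = v i + v j + v k + v l" and "W2 = v i + v j + v k - 3 *\<^sub>R v l"
    and "W3 = v i + v j - 2 *\<^sub>R v k" and "W4 = v i - v j"
  note W_defs = W1_def W2_def W3_def W4_def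
  have W: "W1 \<bullet> W1 = n * n" "W2 \<bullet> W2 = 6 * (m * m)" "W3 \<bullet> W3 = 3 * (m * m)" "W4 \<bullet> W4 = m * m"
    "W1 \<bullet> W2 = 0" "W1 \<bullet> W3 = 0" "W1 \<bullet> W4 = 0" "W2 \<bullet> W3 = 0" "W2 \<bullet> W4 = 0" "W3 \<bullet> W4 = 0"
    unfolding n(2) m(2) W_defs using ne
    by (simp_all add: inner_add_left inner_add_right inner_diff_left inner_diff_right inner_distinct)
  define U1 where "U1 = (1 / n) *\<^sub>R W1"
  define U2 where "U2 = (1 / (sqrt 6 * m)) *\<^sub>R W2"
  define U3 where "U3 = (1 / (sqrt 3 * m)) *\<^sub>R W3"
  define U4 where "U4 = (1 / m) *\<^sub>R W4"
  note U_defs = U1_def U2_def U3_def U4_def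
  define T where "T w = w $ 1 *\<^sub>R U1 + w $ 2 *\<^sub>R U2 + w $ 3 *\<^sub>R U3 + w $ 4 *\<^sub>R U4" for w :: "real ^ 4"
  have orthonormal: "U1 \<bullet> U1 = 1" "U2 \<bullet> U2 = 1" "U3 \<bullet> U3 = 1" "U4 \<bullet> U4 = 1"
    "U1 \<bullet> U2 = 0" "U1 \<bullet> U3 = 0" "U1 \<bullet> U4 = 0" "U2 \<bullet> U3 = 0" "U2 \<bullet> U4 = 0" "U3 \<bullet> U4 = 0"
    using n(1) m(1) by (simp_all add: U_defs W)
  have T: "orthogonal_transformation T"
    unfolding orthogonal_transformation_def
  proof
    show "linear T" by (rule linearI) (simp_all add: T_def algebra_simps)
    have "T x \<bullet> T y = x $ 1 * y $ 1 + x $ 2 * y $ 2 + x $ 3 * y $ 3 + x $ 4 * y $ 4" for x y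
      using orthonormal
      by (simp add: T_def inner_add_left inner_add_right
          inner_commute[of U2 U1] inner_commute[of U3 U1] inner_commute[of U4 U1]
          inner_commute[of U3 U2] inner_commute[of U4 U2] inner_commute[of U4 U3])
    then show "\<forall>x y. T x \<bullet> T y = x \<bullet> y"
      by (simp add: inner_vec_def sum_4)
  qed
  \<comment> \<open>The linear change between orthonormal and barycentric coordinates.\<close>
  have T_combination: "T w = combination y"
    if "w $ 1 = n * (y i + y j + y k + y l) / 4"
      "w $ 2 = sqrt 6 * m * (y i + y j + y k - 3 * y l) / 12"
      "w $ 3 = sqrt 3 * m * (y i + y j - 2 * y k) / 6" "w $ 4 = m * (y i - y j) / 2" for w y
  proof -
    define \<alpha> \<beta> \<gamma> \<delta> where "\<alpha> = w $ 1 / n" and "\<beta> = w $ 2 / (sqrt 6 * m)"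
      and "\<gamma> = w $ 3 / (sqrt 3 * m)" and "\<delta> = w $ 4 / m"
    note greek = \<alpha>_def \<beta>_def \<gamma>_def \<delta>_def
    have y: "y i = \<alpha> + \<beta> + \<gamma> + \<delta>" "y j = \<alpha> + \<beta> + \<gamma> - \<delta>" "y k = \<alpha> + \<beta> - 2 * \<gamma>" "y l = \<alpha> - 3 * \<beta>"
      using n(1) m(1) unfolding greek that by (simp_all add: field_simps)
    have "T w = \<alpha> *\<^sub>R (v i + v j + v k + v l) + \<beta> *\<^sub>R (v i + v j + v k - 3 *\<^sub>R v l) +
        \<gamma> *\<^sub>R (v i + v j - 2 *\<^sub>R v k) + \<delta> *\<^sub>R (v i - v j)"
      by (simp add: T_def U_defs W_defs greek)
    then show ?thesis
      by (simp add: sum_UNIV y algebra_simps)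
  qed
  have ex_y: "\<exists>y. w $ 1 = n * (y i + y j + y k + y l) / 4 \<and>
      w $ 2 = sqrt 6 * m * (y i + y j + y k - 3 * y l) / 12 \<and>
      w $ 3 = sqrt 3 * m * (y i + y j - 2 * y k) / 6 \<and> w $ 4 = m * (y i - y j) / 2" for w :: "real ^ 4"
  proof -
    define \<alpha> \<beta> \<gamma> \<delta> where "\<alpha> = w $ 1 / n" and "\<beta> = w $ 2 / (sqrt 6 * m)"
      and "\<gamma> = w $ 3 / (sqrt 3 * m)" and "\<delta> = w $ 4 / m"
    have "w $ 1 = n * \<alpha>" "w $ 2 = sqrt 6 * m * \<beta>" "w $ 3 = sqrt 3 * m * \<gamma>" "w $ 4 = m * \<delta>"
      using n(1) m(1) by (simp_all add: \<alpha>_def \<beta>_def \<gamma>_def \<delta>_def)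
    then show ?thesis
      using ne by (intro exI[of _ "\<lambda>p. if p = i then \<alpha> + \<beta> + \<gamma> + \<delta> else if p = j then \<alpha> + \<beta> + \<gamma> - \<delta>
        else if p = k then \<alpha> + \<beta> - 2 * \<gamma> else \<alpha> - 3 * \<beta>"]) (simp add: algebra_simps)
  qed
  let ?h = "sqrt ((1 - c) / (3 * (1 + 3 * c)))"
  have h: "?h = sqrt 6 * m / (3 * n)"
  proof (rule real_sqrt_unique)
    have "(sqrt 6 * m / (3 * n))\<^sup>2 = 6 * (m * m) / (9 * (n * n))"
      by (simp add: power_divide power_mult_distrib flip: power2_eq_square)
    also have "\<dots> = (1 - c) / (3 * (1 + 3 * c))"
      unfolding n(2) m(2) using c1 by (simp add: field_simps)
    finally show "(sqrt 6 * m / (3 * n))\<^sup>2 = (1 - c) / (3 * (1 + 3 * c))" .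
  qed (use n m in simp)
  \<comment> \<open>The four inequalities of the orthoscheme sector say, one by one, that the barycentric coordinates
      decrease along \<open>i, j, k, l\<close> and that the last one is nonnegative.\<close>
  have key: "w \<in> orthoscheme_sector ?h (sqrt 2) (sqrt 3) \<longleftrightarrow> T w \<in> sector_piece xs"
    if w: "w $ 1 = n * (y i + y j + y k + y l) / 4"
      "w $ 2 = sqrt 6 * m * (y i + y j + y k - 3 * y l) / 12"
      "w $ 3 = sqrt 3 * m * (y i + y j - 2 * y k) / 6" "w $ 4 = m * (y i - y j) / 2" for w y
  proof -
    have cancel: "r * s / t \<le> r * s' / t \<longleftrightarrow> s \<le> s'" if "0 < r" "0 < t" for r s s' t :: real
      using that by (simp add: divide_le_cancel)
    have s26: "sqrt 2 * sqrt 6 = 2 * sqrt 3"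
      using real_sqrt_mult[of 2 3] by simp
    have 1: "0 \<le> w $ 4 \<longleftrightarrow> y j \<le> y i"
      using m(1) by (simp add: w zero_le_mult_iff)
    have "sqrt 3 * w $ 3 = (sqrt 3 * sqrt 3) * m * (y i + y j - 2 * y k) / 6"
      unfolding w(3) by (simp only: times_divide_eq_right mult.assoc)
    also have "\<dots> = m * (y i + y j - 2 * y k) / 2" by simp
    finally have 2: "w $ 4 \<le> sqrt 3 * w $ 3 \<longleftrightarrow> y k \<le> y j"
      using m(1) by (simp add: w(4) cancel)
    have "sqrt 2 * w $ 2 = (sqrt 2 * sqrt 6) * m * (y i + y j + y k - 3 * y l) / 12"
      unfolding w(2) by (simp only: times_divide_eq_right mult.assoc)
    also have "\<dots> = sqrt 3 * m * (y i + y j + y k - 3 * y l) / 6" unfolding s26 by simp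
    finally have 3: "w $ 3 \<le> sqrt 2 * w $ 2 \<longleftrightarrow> y l \<le> y k"
      using m(1) by (simp add: w(3) cancel)
    have "?h * w $ 1 = sqrt 6 * m * (y i + y j + y k + y l) / 12"
      unfolding h w using n(1) by simp
    then have 4: "w $ 2 \<le> ?h * w $ 1 \<longleftrightarrow> 0 \<le> y l"
      using m(1) by (simp add: w(2) cancel)
    have sorted_iff: "sorted (map (\<lambda>m. - (combination y \<bullet> v m)) xs) \<longleftrightarrow> y j \<le> y i \<and> y k \<le> y j \<and> y l \<le> y k"
      using c1(1) by (auto simp: xs inner_combination)
    have pos_iff: "(\<forall>m. 0 \<le> y m) \<longleftrightarrow> 0 \<le> y i \<and> 0 \<le> y j \<and> 0 \<le> y k \<and> 0 \<le> y l"
      using UN by (metis UNIV_I empty_iff insert_iff)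
    have "norm w = norm (combination y)"
      using orthogonal_transformation_norm[OF T, of w] T_combination[OF w] by simp
    then show ?thesis
      unfolding orthoscheme_sector_def sector_piece_def mem_Collect_eq T_combination[OF w] 1 2 3 4
        combination_in_convex_cone_hull_iff sorted_iff pos_iff
      by auto
  qed
  show thesis
  proof (rule that[OF T])
    show "T ` orthoscheme_sector ?h (sqrt 2) (sqrt 3) = sector_piece xs"
    proof
      show "T ` orthoscheme_sector ?h (sqrt 2) (sqrt 3) \<subseteq> sector_piece xs"
        using ex_y key by blast
      show "sector_piece xs \<subseteq> T ` orthoscheme_sector ?h (sqrt 2) (sqrt 3)"
      proof
        fix x assume x: "x \<in> sector_piece xs"
        obtain w where "x = T w"
          using orthogonal_transformation_surj[OF T] by (metis surjD)
        with x ex_y[of w] key show "x \<in> T ` orthoscheme_sector ?h (sqrt 2) (sqrt 3)" by blast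
      qed
    qed
  qed
qed

lemma Union_sector_piece:
  "(\<Union>xs\<in>{xs. length xs = 4 \<and> distinct xs}. sector_piece xs) = {x \<in> convex_cone hull (range v). norm x \<le> 1}"
proof -
  have "\<exists>xs. length xs = 4 \<and> distinct xs \<and> sorted (map (\<lambda>m. - (x \<bullet> v m)) xs)" for x :: "real ^ 4"
    by (rule exI[of _ "sort_key (\<lambda>m. - (x \<bullet> v m)) [1, 2, 3, 4]"]) simp
  then show ?thesis by (fastforce simp: sector_piece_def)
qed

text \<open>
  If the inner products of a point with the vertices are distinct, there is only one way of sorting
  them. So two chambers can meet only in the hyperplanes that bisect pairs of vertices.
\<close>

lemma negligible_Int_sector_piece:
  assumes "length xs = 4" "distinct xs" "length ys = 4" "distinct ys" "xs \<noteq> ys"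
  shows "negligible (sector_piece xs \<inter> sector_piece ys)"
proof (rule negligible_subset)
  let ?H = "\<lambda>(i, j). {x. (v i - v j) \<bullet> x = 0}"
  show "negligible (\<Union> (?H ` {(i, j). i \<noteq> j}))"
  proof (intro negligible_Union finite_imageI)
    fix S assume "S \<in> ?H ` {(i, j). i \<noteq> j}"
    then obtain i j where "i \<noteq> j" and S: "S = {x. (v i - v j) \<bullet> x = 0}" by auto
    then have "v i \<noteq> v j" using inner_distinct[of i j] c_less by auto
    then show "negligible S" unfolding S by (intro negligible_hyperplane) auto
  qed auto
  show "sector_piece xs \<inter> sector_piece ys \<subseteq> \<Union> (?H ` {(i, j). i \<noteq> j})"
  proof
    fix x assume "x \<in> sector_piece xs \<inter> sector_piece ys"
    then have sorted: "sorted (map (\<lambda>m. - (x \<bullet> v m)) xs)" "sorted (map (\<lambda>m. - (x \<bullet> v m)) ys)"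
      by (auto simp: sector_piece_def)
    have "set zs = UNIV" if "length zs = 4" "distinct zs" for zs :: "4 list"
      using that by (intro card_subset_eq) (simp_all add: distinct_card)
    then have "set xs = set ys" using assms by simp
    then have "\<not> inj (\<lambda>m. - (x \<bullet> v m))"
      using map_sorted_distinct_set_unique[OF _ sorted(1) _ sorted(2)] assms
      by (metis distinct_map inj_on_subset subset_UNIV)
    then obtain i j where "i \<noteq> j" "x \<bullet> v i = x \<bullet> v j" by (auto simp: inj_def)
    then have "x \<in> ?H (i, j)" by (simp add: inner_diff_left inner_commute[of _ x])
    with \<open>i \<noteq> j\<close> show "x \<in> \<Union> (?H ` {(i, j). i \<noteq> j})" by blast
  qed
qed

lemma measure_cone_eq_24_orthoscheme_sectors:
  "measure lebesgue {x \<in> convex_cone hull (range v). norm x \<le> 1} =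
     24 * measure lebesgue (orthoscheme_sector (sqrt ((1 - c) / (3 * (1 + 3 * c)))) (sqrt 2) (sqrt 3))"
    (is "_ = 24 * measure lebesgue ?O")
proof -
  let ?I = "{xs :: 4 list. length xs = 4 \<and> distinct xs}"
  have O: "?O \<in> lmeasurable" by (rule lmeasurable_compact[OF compact_orthoscheme_sector])
  have piece: "sector_piece xs \<in> lmeasurable" "measure lebesgue (sector_piece xs) = measure lebesgue ?O"
    if xs: "xs \<in> ?I" for xs
  proof -
    obtain T where T: "orthogonal_transformation T" "T ` ?O = sector_piece xs"
      using sector_piece_isometric xs by blast
    show "sector_piece xs \<in> lmeasurable" "measure lebesgue (sector_piece xs) = measure lebesgue ?O"
      using measurable_orthogonal_image[OF T(1) O] measure_orthogonal_image[OF T(1) O] unfolding T(2) .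
  qed
  have card: "card ?I = 24"
    using card_lists_distinct_length_eq[of "UNIV :: 4 set" 4]
    by (simp add: numeral_eq_Suc prod.atLeast_Suc_atMost)
  have "finite ?I" by (rule card_ge_0_finite) (simp only: card)
  moreover have "pairwise (\<lambda>xs ys. negligible (sector_piece xs \<inter> sector_piece ys)) ?I"
    by (intro pairwiseI negligible_Int_sector_piece) auto
  ultimately have "measure lebesgue (\<Union>xs\<in>?I. sector_piece xs) = (\<Sum>xs\<in>?I. measure lebesgue (sector_piece xs))"
    by (intro measure_negligible_finite_Union_image piece(1))
  also have "\<dots> = 24 * measure lebesgue ?O"
    using piece card by simp
  finally show ?thesis by (simp add: Union_sector_piece)
qed

end

section \<open>Regular tetrahedra parametrised by the inscribed radius\<close>

text \<open>
  A regular tetrahedron whose inscribed sphere has radius \<open>arctan x\<close> has, in the gnomonic chart at its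
  centre, faces at distance \<open>x\<close>, edges at distance \<open>sqrt 3 x\<close> and vertices at distance \<open>3 x\<close> from
  the origin. The next two functions are its edge length and its dihedral angle.
\<close>

definition edge_length :: "real \<Rightarrow> real" where
  "edge_length x = 2 * arctan (sqrt 6 * x / sqrt (1 + 3 * x\<^sup>2))"

definition dihedral :: "real \<Rightarrow> real" where
  "dihedral x = arccos ((1 - 3 * x\<^sup>2) / (3 * (1 + x\<^sup>2)))"

lemma one_plus_square_pos: "0 < 1 + (x::real)\<^sup>2" "0 < 1 + 3 * x\<^sup>2" "0 < 1 + 9 * x\<^sup>2"
  by (simp_all add: add_pos_nonneg)

lemma cos_edge_length: "cos (edge_length x) = (1 - 3 * x\<^sup>2) / (1 + 9 * x\<^sup>2)"
  and sin_edge_length: "sin (edge_length x) = 2 * sqrt 6 * x * sqrt (1 + 3 * x\<^sup>2) / (1 + 9 * x\<^sup>2)"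
proof -
  define r where "r = sqrt (1 + 3 * x\<^sup>2)"
  have r: "0 < r" "r\<^sup>2 = 1 + 3 * x\<^sup>2" using one_plus_square_pos(2)[of x] by (simp_all add: r_def)
  define u where "u = sqrt 6 * x / r"
  have u: "u\<^sup>2 = 6 * x\<^sup>2 / r\<^sup>2" by (simp add: u_def power_divide power_mult_distrib)
  have u1: "1 + u\<^sup>2 = (1 + 9 * x\<^sup>2) / r\<^sup>2" "1 - u\<^sup>2 = (1 - 3 * x\<^sup>2) / r\<^sup>2"
    using one_plus_square_pos(2)[of x] unfolding u r(2) by (simp_all add: field_simps)
  have pos: "0 < 1 + u\<^sup>2" by (rule one_plus_square_pos)
  have "cos (2 * arctan u) = (1 / sqrt (1 + u\<^sup>2))\<^sup>2 - (u / sqrt (1 + u\<^sup>2))\<^sup>2"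
    unfolding cos_double cos_arctan sin_arctan ..
  also have "\<dots> = (1 - u\<^sup>2) / (1 + u\<^sup>2)"
    using pos by (simp add: power_divide diff_divide_distrib)
  also have "\<dots> = (1 - 3 * x\<^sup>2) / (1 + 9 * x\<^sup>2)"
    using r(1) by (simp add: u1)
  finally show "cos (edge_length x) = (1 - 3 * x\<^sup>2) / (1 + 9 * x\<^sup>2)"
    by (simp add: edge_length_def u_def r_def)
  have "sin (2 * arctan u) = 2 * (u / sqrt (1 + u\<^sup>2)) * (1 / sqrt (1 + u\<^sup>2))"
    unfolding sin_double cos_arctan sin_arctan ..
  also have "\<dots> = 2 * u / (1 + u\<^sup>2)" using pos by simp
  also have "\<dots> = 2 * sqrt 6 * x * r / (1 + 9 * x\<^sup>2)"
    using r(1) unfolding u1(1) by (simp add: u_def power2_eq_square)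
  finally show "sin (edge_length x) = 2 * sqrt 6 * x * sqrt (1 + 3 * x\<^sup>2) / (1 + 9 * x\<^sup>2)"
    by (simp add: edge_length_def u_def r_def)
qed

lemma edge_length_eq_arccos:
  assumes "0 \<le> x"
  shows "edge_length x = arccos ((1 - 3 * x\<^sup>2) / (1 + 9 * x\<^sup>2))"
proof -
  have "0 \<le> arctan (sqrt 6 * x / sqrt (1 + 3 * x\<^sup>2))"
    using assms by (simp add: zero_le_arctan_iff add_nonneg_nonneg)
  then have "0 \<le> edge_length x" "edge_length x \<le> pi"
    unfolding edge_length_def using arctan_ubound[of "sqrt 6 * x / sqrt (1 + 3 * x\<^sup>2)"] by auto
  then show ?thesis by (metis arccos_cos cos_edge_length)
qed

lemma has_real_derivative_edge_length:
  "(edge_length has_real_derivative 2 * sqrt 6 / ((1 + 9 * x\<^sup>2) * sqrt (1 + 3 * x\<^sup>2))) (at x within S)"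
proof -
  define r where "r = sqrt (1 + 3 * x\<^sup>2)"
  have r: "0 < r" "r\<^sup>2 = 1 + 3 * x\<^sup>2" using one_plus_square_pos(2)[of x] by (simp_all add: r_def)
  have "((\<lambda>x. sqrt (1 + 3 * x\<^sup>2)) has_real_derivative 3 * x / r) (at x within S)"
    using one_plus_square_pos(2)[of x] by (auto intro!: derivative_eq_intros simp: r_def field_simps)
  from DERIV_divide[OF DERIV_cmult_Id this]
  have "((\<lambda>x. sqrt 6 * x / sqrt (1 + 3 * x\<^sup>2)) has_real_derivative
      (sqrt 6 * r - sqrt 6 * x * (3 * x / r)) / (r * r)) (at x within S)"
    using r(1) by (simp add: r_def)
  moreover have "(sqrt 6 * r - sqrt 6 * x * (3 * x / r)) / (r * r) = sqrt 6 / (r * r\<^sup>2)"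
  proof -
    have "sqrt 6 * r - sqrt 6 * x * (3 * x / r) = sqrt 6 * (r\<^sup>2 - 3 * x\<^sup>2) / r"
      using r(1) by (simp add: field_simps power2_eq_square)
    also have "\<dots> = sqrt 6 / r" by (simp add: r(2))
    finally show ?thesis by (simp add: power2_eq_square)
  qed
  ultimately have "((\<lambda>x. sqrt 6 * x / sqrt (1 + 3 * x\<^sup>2)) has_real_derivative sqrt 6 / (r * r\<^sup>2)) (at x within S)"
    by simp
  then have "(edge_length has_real_derivative
      2 * (inverse (1 + (sqrt 6 * x / sqrt (1 + 3 * x\<^sup>2))\<^sup>2) * (sqrt 6 / (r * r\<^sup>2)))) (at x within S)"
    unfolding edge_length_def by (intro DERIV_cmult DERIV_chain2[OF DERIV_arctan])
  also have "1 + (sqrt 6 * x / sqrt (1 + 3 * x\<^sup>2))\<^sup>2 = (1 + 9 * x\<^sup>2) / r\<^sup>2"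
    using one_plus_square_pos(2)[of x] by (simp add: r power_divide power_mult_distrib field_simps flip: r_def)
  also have "2 * (inverse ((1 + 9 * x\<^sup>2) / r\<^sup>2) * (sqrt 6 / (r * r\<^sup>2))) = 2 * sqrt 6 / ((1 + 9 * x\<^sup>2) * r)"
    using r(1) one_plus_square_pos(3)[of x] by simp
  finally show ?thesis by (simp add: r_def)
qed

lemma has_real_derivative_dihedral:
  "(dihedral has_real_derivative 2 * sqrt 2 * x / ((1 + x\<^sup>2) * sqrt (1 + 3 * x\<^sup>2))) (at x within S)"
proof -
  define e where "e = 1 + x\<^sup>2"
  have e: "0 < e" unfolding e_def by (rule one_plus_square_pos)
  define r where "r = sqrt (1 + 3 * x\<^sup>2)"
  have r: "0 < r" "r\<^sup>2 = 1 + 3 * x\<^sup>2" using one_plus_square_pos(2)[of x] by (simp_all add: r_def)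
  define u where "u = (1 - 3 * x\<^sup>2) / (3 * (1 + x\<^sup>2))"
  have "1 - u\<^sup>2 = ((3 * e)\<^sup>2 - (1 - 3 * x\<^sup>2)\<^sup>2) / (3 * e)\<^sup>2"
    unfolding u_def e_def[symmetric] power_divide diff_divide_distrib[of "(3 * e)\<^sup>2"] using e by simp
  also have "(3 * e)\<^sup>2 - (1 - 3 * x\<^sup>2)\<^sup>2 = 8 * r\<^sup>2"
    unfolding e_def r(2) by (simp add: power2_eq_square algebra_simps)
  finally have u2: "1 - u\<^sup>2 = 8 * r\<^sup>2 / (3 * e)\<^sup>2" .
  have "sqrt 8 = 2 * sqrt 2" using real_sqrt_mult[of 4 2] by simp
  then have root: "sqrt (1 - u\<^sup>2) = 2 * sqrt 2 * r / (3 * e)"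
    unfolding u2 using e r(1) by (simp add: real_sqrt_mult real_sqrt_divide)
  have "0 < 1 - u\<^sup>2" unfolding u2 using e r(1) by simp
  then have "u\<^sup>2 < 1" by simp
  then have u: "- 1 < u" "u < 1" by (simp_all add: power2_less_1_iff abs_less_iff)
  have "((\<lambda>x. (1 - 3 * x\<^sup>2) / (3 * (1 + x\<^sup>2))) has_real_derivative
      ((- 6 * x) * (3 * e) - (1 - 3 * x\<^sup>2) * (6 * x)) / ((3 * e) * (3 * e))) (at x within S)"
    using e by (auto intro!: derivative_eq_intros simp: e_def)
  then have "(dihedral has_real_derivative inverse (- sqrt (1 - u\<^sup>2)) *
      (((- 6 * x) * (3 * e) - (1 - 3 * x\<^sup>2) * (6 * x)) / ((3 * e) * (3 * e)))) (at x within S)"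
    unfolding dihedral_def u_def
    by (intro DERIV_chain2[OF DERIV_arccos]) (use u in \<open>simp_all add: u_def\<close>)
  also have "(- 6 * x) * (3 * e) - (1 - 3 * x\<^sup>2) * (6 * x) = - 24 * x"
    by (simp add: e_def power2_eq_square algebra_simps)
  also have "inverse (- sqrt (1 - u\<^sup>2)) * (- 24 * x / ((3 * e) * (3 * e))) = 2 * (2 / sqrt 2) * x / (e * r)"
    unfolding root using e r(1) by (simp add: field_simps)
  also have "2 / sqrt 2 = sqrt 2" by (simp add: real_div_sqrt)
  finally show ?thesis by (simp add: e_def r_def)
qed

text \<open>
  The substitution \<open>t = edge_length x\<close>. All square roots are multiples of \<open>sqrt (1 + 3 x\<^sup>2)\<close>, because
  \<open>(1 + cos t) (1 + 3 cos t) = 8 (1 + 3 x\<^sup>2) / (1 + 9 x\<^sup>2)\<^sup>2\<close>.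
\<close>

lemma integral_over_edge_length:
  assumes "0 \<le> h"
  shows "(LBINT x=0..h. 6 * sqrt 2 * x / ((1 + x\<^sup>2) * sqrt (1 + 3 * x\<^sup>2)) * edge_length x) =
    (LBINT t=0..edge_length h. 3 * t * sin t / ((1 + 2 * cos t) * sqrt ((1 + cos t) * (1 + 3 * cos t))))"
proof -
  let ?f = "\<lambda>t. 3 * t * sin t / ((1 + 2 * cos t) * sqrt ((1 + cos t) * (1 + 3 * cos t)))"
  let ?g' = "\<lambda>x::real. 2 * sqrt 6 / ((1 + 9 * x\<^sup>2) * sqrt (1 + 3 * x\<^sup>2))"
  have c: "1 + 2 * cos (edge_length x) = 3 * (1 + x\<^sup>2) / (1 + 9 * x\<^sup>2)"
    "1 + cos (edge_length x) = 2 * (1 + 3 * x\<^sup>2) / (1 + 9 * x\<^sup>2)"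
    "1 + 3 * cos (edge_length x) = 4 / (1 + 9 * x\<^sup>2)" for x
    unfolding cos_edge_length using one_plus_square_pos(3)[of x] by (simp_all add: field_simps)
  have pos: "0 < 1 + 2 * cos (edge_length x)" "0 < (1 + cos (edge_length x)) * (1 + 3 * cos (edge_length x))" for x
    unfolding c using one_plus_square_pos[of x] by simp_all
  have integrand: "?g' x *\<^sub>R ?f (edge_length x) =
      6 * sqrt 2 * x / ((1 + x\<^sup>2) * sqrt (1 + 3 * x\<^sup>2)) * edge_length x" for x
  proof -
    define r where "r = sqrt (1 + 3 * x\<^sup>2)"
    have r: "0 < r" "r\<^sup>2 = 1 + 3 * x\<^sup>2" using one_plus_square_pos(2)[of x] by (simp_all add: r_def)
    define d where "d = 1 + 9 * x\<^sup>2"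
    define e where "e = 1 + x\<^sup>2"
    have de: "0 < d" "0 < e" unfolding d_def e_def by (rule one_plus_square_pos)+
    have s8: "sqrt 8 = 2 * sqrt 2" using real_sqrt_mult[of 4 2] by simp
    have "sqrt ((1 + cos (edge_length x)) * (1 + 3 * cos (edge_length x))) = sqrt (8 * r\<^sup>2 / d\<^sup>2)"
      unfolding c d_def[symmetric] r(2)[symmetric] by (simp add: power2_eq_square)
    also have "\<dots> = 2 * sqrt 2 * r / d"
      using r(1) de by (simp add: real_sqrt_mult real_sqrt_divide s8)
    finally have root: "sqrt ((1 + cos (edge_length x)) * (1 + 3 * cos (edge_length x))) = 2 * sqrt 2 * r / d" .
    have "?g' x *\<^sub>R ?f (edge_length x) = (2 * sqrt 6 / (d * r)) *
        (3 * edge_length x * (2 * sqrt 6 * x * r / d) / ((3 * e / d) * (2 * sqrt 2 * r / d)))"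
      unfolding root sin_edge_length c(1) d_def[symmetric] e_def[symmetric] r_def[symmetric] by simp
    also have "\<dots> = 6 * (2 / sqrt 2) * x / (e * r) * edge_length x"
      using r(1) de by (simp add: field_simps)
    also have "2 / sqrt 2 = sqrt 2" by (simp add: real_div_sqrt)
    finally show ?thesis by (simp add: e_def r_def)
  qed
  have "(LBINT x=ereal 0..ereal h. ?g' x *\<^sub>R ?f (edge_length x)) =
      (LBINT t=ereal (edge_length 0)..ereal (edge_length h). ?f t)"
  proof (rule interval_integral_substitution_finite[OF assms])
    show "(edge_length has_real_derivative ?g' x) (at x within {0..h})" for x
      by (rule has_real_derivative_edge_length)
    show "continuous_on (edge_length ` {0..h}) ?f"
      using pos by (intro continuous_intros) (auto simp: less_le)
    show "continuous_on {0..h} ?g'"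
      using one_plus_square_pos(2,3) by (intro continuous_intros) (auto simp: less_le)
  qed
  then show ?thesis
    unfolding integrand by (simp add: edge_length_def zero_ereal_def)
qed

text \<open>
  The substitution \<open>\<phi> = dihedral x\<close>. The integrand is the edge length as a function of the dihedral
  angle, since \<open>cos \<phi> / (1 - 2 cos \<phi>)\<close> inverts \<open>c / (1 + 2 c) = cos \<phi>\<close>; the lower limit is the
  Euclidean dihedral angle, the limit of tetrahedra that shrink to a point.
\<close>

lemma integral_over_dihedral:
  assumes "0 \<le> h"
  shows "(LBINT x=0..h. 2 * sqrt 2 * x / ((1 + x\<^sup>2) * sqrt (1 + 3 * x\<^sup>2)) * edge_length x) =
    (LBINT \<phi>=ereal (arccos (1 / 3))..ereal (dihedral h). arccos (cos \<phi> / (1 - 2 * cos \<phi>)))"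
proof -
  let ?f = "\<lambda>\<phi>. arccos (cos \<phi> / (1 - 2 * cos \<phi>))"
  let ?g' = "\<lambda>x::real. 2 * sqrt 2 * x / ((1 + x\<^sup>2) * sqrt (1 + 3 * x\<^sup>2))"
  have cos_dihedral: "cos (dihedral x) = (1 - 3 * x\<^sup>2) / (3 * (1 + x\<^sup>2))" for x
    unfolding dihedral_def
    by (rule cos_arccos) (use one_plus_square_pos(1)[of x] in \<open>simp_all add: field_simps\<close>)
  have d: "1 - 2 * cos (dihedral x) = (1 + 9 * x\<^sup>2) / (3 * (1 + x\<^sup>2))" for x
    unfolding cos_dihedral using one_plus_square_pos(1)[of x] by (simp add: field_simps)
  have arg: "cos (dihedral x) / (1 - 2 * cos (dihedral x)) = cos (edge_length x)" for x
    unfolding d unfolding cos_dihedral cos_edge_length using one_plus_square_pos(1)[of x] by simp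
  have integrand: "?g' x *\<^sub>R ?f (dihedral x) = ?g' x * edge_length x" if "0 \<le> x" for x
    unfolding arg by (simp add: edge_length_eq_arccos[OF that] cos_edge_length
      flip: edge_length_eq_arccos[OF that])
  have "(LBINT x=ereal 0..ereal h. ?g' x *\<^sub>R ?f (dihedral x)) =
      (LBINT t=ereal (dihedral 0)..ereal (dihedral h). ?f t)"
  proof (rule interval_integral_substitution_finite[OF assms])
    show "(dihedral has_real_derivative ?g' x) (at x within {0..h})" for x
      by (rule has_real_derivative_dihedral)
    have "1 - 2 * cos (dihedral x) \<noteq> 0" for x
      unfolding d using one_plus_square_pos[of x] by simp
    then show "continuous_on (dihedral ` {0..h}) ?f"
      by (intro continuous_intros) (auto simp: arg)
    show "continuous_on {0..h} ?g'"
      using one_plus_square_pos(1,2) by (intro continuous_intros) (auto simp: less_le)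
  qed
  moreover have "(LBINT x=ereal 0..ereal h. ?g' x *\<^sub>R ?f (dihedral x)) = (LBINT x=ereal 0..ereal h. ?g' x * edge_length x)"
    by (intro interval_integral_cong integrand) (use assms in \<open>auto simp: einterval_iff\<close>)
  ultimately show ?thesis
    by (simp add: dihedral_def zero_ereal_def)
qed

section \<open>The volume formulae\<close>

lemma equiangular_frame_regular_spherical_tetrahedron:
  assumes "regular_spherical_tetrahedron v a"
  shows "equiangular_frame v (cos a)"
proof
  have unit: "norm (v i) = 1" and dist: "i \<noteq> j \<Longrightarrow> arccos (v i \<bullet> v j) = a"
    and inj: "inj v" and indep: "independent (range v)" for i j
    using assms
    by (auto simp: regular_spherical_tetrahedron_def nondegenerate_vertices_def sphere_dist_def
        dest: subsetD[OF _ rangeI])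
  show same: "v i \<bullet> v i = 1" for i using unit by (simp add: norm_eq_1)
  show distinct: "v i \<bullet> v j = cos a" if "i \<noteq> j" for i j
  proof -
    have "\<bar>v i \<bullet> v j\<bar> \<le> 1" using Cauchy_Schwarz_ineq2[of "v i" "v j"] by (simp add: unit)
    then show ?thesis using dist[OF that] cos_arccos[of "v i \<bullet> v j"] by (simp add: abs_le_iff)
  qed
  have "v 1 \<noteq> v 2" using inj by (simp add: inj_eq)
  then have "0 < (v 1 - v 2) \<bullet> (v 1 - v 2)" by simp
  then show "cos a < 1"
    by (simp add: inner_diff_left inner_diff_right same distinct)
  have "v 1 + v 2 + v 3 + v 4 \<noteq> 0"
  proof
    assume "v 1 + v 2 + v 3 + v 4 = 0"
    then have "(\<Sum>x\<in>range v. 1 *\<^sub>R x) = 0"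
      using inj by (simp add: sum.reindex sum_4)
    then show False
      using independentD[OF indep, of "range v" "\<lambda>_. 1" "v 1"] by simp
  qed
  then have "0 < (v 1 + v 2 + v 3 + v 4) \<bullet> (v 1 + v 2 + v 3 + v 4)" by simp
  then show "- 1 / 3 < cos a"
    by (simp add: inner_add_left inner_add_right same distinct)
qed

text \<open>
  A cone meets the unit ball in the union of the radii towards its points on the sphere; the apex
  is covered because the simplex is not empty.
\<close>

lemma cone_over_spherical_simplex:
  fixes v :: "'n::finite \<Rightarrow> real ^ 'n"
  assumes "range v \<subseteq> sphere 0 1"
  shows "{r *\<^sub>R x | r x. 0 \<le> r \<and> r \<le> 1 \<and> x \<in> spherical_simplex v} =
    {x \<in> convex_cone hull (range v). norm x \<le> 1}" (is "?L = ?R")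
proof
  show "?L \<subseteq> ?R"
    by (auto simp: spherical_simplex_def intro: convex_cone_hull_mul)
  show "?R \<subseteq> ?L"
  proof
    fix x assume x: "x \<in> ?R"
    show "x \<in> ?L"
    proof (cases "x = 0")
      case True
      have "v undefined \<in> spherical_simplex v"
        using subsetD[OF assms rangeI[of v undefined]]
        by (auto simp: spherical_simplex_def intro: hull_inc)
      then show ?thesis using True by (intro CollectI exI[of _ 0] exI[of _ "v undefined"]) simp
    next
      case False
      have "sgn x \<in> convex_cone hull (range v)"
        using x unfolding sgn_div_norm by (intro convex_cone_hull_mul) auto
      moreover have "norm (sgn x) = 1" using False by (simp add: norm_sgn)
      moreover have "x = norm x *\<^sub>R sgn x" using False by (simp add: sgn_div_norm)
      ultimately show ?thesis
        using x unfolding spherical_simplex_def by (intro CollectI exI[of _ "norm x"] exI[of _ "sgn x"]) auto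
    qed
  qed
qed

theorem theorem1:
  fixes v :: "4 \<Rightarrow> real ^ 4" and a A :: real
  assumes "regular_spherical_tetrahedron v a"
    and "\<And>i j. i \<noteq> j \<Longrightarrow> dihedral_angle v i j = A"
  shows "sphere_volume (spherical_simplex v) =
           3 * (LBINT \<phi>=ereal (arccos (1 / 3))..ereal A. arccos (cos \<phi> / (1 - 2 * cos \<phi>)))
       \<and> sphere_volume (spherical_simplex v) =
           (LBINT t=ereal 0..ereal a.
              3 * t * sin t / ((1 + 2 * cos t) * sqrt ((1 + cos t) * (1 + 3 * cos t))))"
proof -
  define c where "c = cos a"
  interpret equiangular_frame v c
    unfolding c_def using assms(1) by (rule equiangular_frame_regular_spherical_tetrahedron)
  have ranges: "range v \<subseteq> sphere 0 1"
    using assms(1) by (simp add: regular_spherical_tetrahedron_def nondegenerate_vertices_def)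
  have c1: "0 < 1 - c" "0 < 1 + 3 * c" using c_less c_greater by auto
  \<comment> \<open>The tangent of the inscribed radius, found by solving \<open>c = (1 - 3 h\<^sup>2) / (1 + 9 h\<^sup>2)\<close>.\<close>
  define h where "h = sqrt ((1 - c) / (3 * (1 + 3 * c)))"
  have h: "0 < h" using c1 by (simp add: h_def)
  have h2: "h\<^sup>2 = (1 - c) / (3 * (1 + 3 * c))" using c1 by (simp add: h_def)
  have "(1 - 3 * h\<^sup>2) / (1 + 9 * h\<^sup>2) = c"
    unfolding h2 using c1 by (simp add: field_simps)
  moreover have "a = arccos c"
  proof -
    have "(1::4) \<noteq> 2" by simp
    then have "a = arccos (v 1 \<bullet> v 2)"
      using assms(1) by (simp add: regular_spherical_tetrahedron_def sphere_dist_def)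
    then show ?thesis by (simp add: inner_distinct)
  qed
  ultimately have a: "edge_length h = a"
    using h by (simp add: edge_length_eq_arccos)
  have "1 - 3 * h\<^sup>2 = 4 * c / (1 + 3 * c)" "3 * (1 + h\<^sup>2) = 4 * (1 + 2 * c) / (1 + 3 * c)"
    unfolding h2 using c1 by (simp_all add: field_simps)
  then have "(1 - 3 * h\<^sup>2) / (3 * (1 + h\<^sup>2)) = 4 * c / (4 + 8 * c)"
    using c1 by simp
  also have "\<dots> = c / (1 + 2 * c)"
  proof -
    have "0 < 1 + 2 * c" "0 < 4 + 8 * c" using c_greater by auto
    then show ?thesis by (simp add: field_simps)
  qed
  finally have A: "dihedral h = A"
    using assms(2)[of 1 2] dihedral_angle_eq[of 1 2] by (simp add: dihedral_def)
  let ?F = "\<lambda>x. 2 * sqrt 2 * x / ((1 + x\<^sup>2) * sqrt (1 + 3 * x\<^sup>2)) * edge_length x"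
  have density: "32 * orthoscheme_density (sqrt 2) (sqrt 3) x = ?F x" for x
  proof -
    have "sqrt 2 * x * sqrt 3 = sqrt 6 * x" using real_sqrt_mult[of 2 3] by simp
    moreover have "1 + x\<^sup>2 + (sqrt 2 * x)\<^sup>2 = 1 + 3 * x\<^sup>2" by (simp add: power_mult_distrib)
    moreover have "32 * (sqrt 2 * x / (8 * e * r) * w) = 2 * sqrt 2 * x / (e * r) * (2 * w)" for e r w :: real
      by simp
    ultimately show ?thesis
      unfolding orthoscheme_density_def edge_length_def by (simp only:)
  qed
  \<comment> \<open>The factor 96 is 4, from the dimension in the definition of the surface measure, times the 24
      chambers.\<close>
  have "sphere_volume (spherical_simplex v) =
      96 * (LBINT x=0..h. orthoscheme_density (sqrt 2) (sqrt 3) x)"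
    unfolding sphere_volume_def cone_over_spherical_simplex[OF ranges] measure_cone_eq_24_orthoscheme_sectors h_def[symmetric]
    using h by (simp add: measure_orthoscheme_sector)
  also have "\<dots> = 3 * (LBINT x=0..h. 32 * orthoscheme_density (sqrt 2) (sqrt 3) x)"
    by simp
  finally have V: "sphere_volume (spherical_simplex v) = 3 * (LBINT x=0..h. ?F x)"
    unfolding density .
  also have "\<dots> = (LBINT x=0..h. 3 * ?F x)"
    by (rule interval_lebesgue_integral_mult_right[symmetric])
  also have "(\<lambda>x. 3 * ?F x) =
      (\<lambda>x. 6 * sqrt 2 * x / ((1 + x\<^sup>2) * sqrt (1 + 3 * x\<^sup>2)) * edge_length x)"
    by (simp add: mult.assoc)
  finally have V': "sphere_volume (spherical_simplex v) =
      (LBINT x=0..h. 6 * sqrt 2 * x / ((1 + x\<^sup>2) * sqrt (1 + 3 * x\<^sup>2)) * edge_length x)" .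
  show ?thesis
    using V V' integral_over_dihedral[of h] integral_over_edge_length[of h] h
    by (simp add: a A zero_ereal_def)
qed

end
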